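(* Let $\mu\in\mathcal P$ and let $Y_N\subset Y$ be a finite dimensional subspace. Let $(u,y,p)\in U_{ad}\times Y\times Y$ be the solution of the optimality system \begin{align*} & a(y,v;\mu)=b(u,v;\mu)+f(v;\mu)\quad\forall v\in Y,\\ & a(v,p;\mu)=(y-z,v)_{L^2(\Omega_0)}\quad\forall v\in Y,\\ & b(v-u,p;\mu)+\alpha(u,v-u)_U\ge 0\quad\forall v\in U_{ad}, \end{align*} and let $(u_N,y_N,p_N)\in U_{ad}\times Y_N\times Y_N$ be the solution of the reduced optimality system \begin{align*} & a(y_N,v_N;\mu)=b(u_N,v_N;\mu)+f(v_N;\mu)\quad\forall v_N\in Y_N,\\ & a(v_N,p_N;\mu)=(y_N-z,v_N)_{L^2(\Omega_0)}\quad\forall v_N\in Y_N,\\ & b(v-u_N,p_N;\mu)+\alpha(u_N,v-u_N)_U\ge 0\quad\forall v\in U_{ad}. \end{align*} Define $r_y(\cdot;\mu),r_p(\cdot;\mu)\in Y^\ast$ by $$r_y(v;\mu):=b(u_N,v;\mu)+f(v;\mu)-a(y_N,v;\mu),\qquad r_p(v;\mu):=(y_N-z,v)_{L^2(\Omega_0)}-a(v,p_N;\mu)\qquad\forall v\in Y,$$ and set $$\Delta_u(\mu):=\frac{1}{\rho_1\sqrt{\alpha}\,\beta(\mu)}\|r_y(\cdot;\mu)\|_{Y^\ast}+\frac{\kappa(\mu)}{\alpha\,\beta(\mu)}\|r_p(\cdot;\mu)\|_{Y^\ast}.$$ If $u_N\neq 0$ and $\dfrac{2\Delta_u(\mu)}{\|u_N\|_U}\le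 1$, then $$\frac{\|u-u_N\|_U}{\|u\|_U}\le\frac{2\Delta_u(\mu)}{\|u_N\|_U}.$$
   Context: Setting. $\mathcal P\subset\mathbb R^p$ is a compact set of parameters. $\Omega\subset\mathbb R^d$, $d\in\{1,2,3\}$, is a bounded domain and $\Omega_0\subseteq\Omega$ an open subset. $Y$ is a (conforming) space of piecewise linear continuous finite elements, i.e. a finite dimensional subspace of $H^1(\Omega)$, equipped with an inner product $(\cdot,\cdot)_Y$ and norm $\|\cdot\|_Y=\sqrt{(\cdot,\cdot)_Y}$; there are constants $\rho_1,\rho_2>0$ with $\rho_1\|y\|_{H^1(\Omega)}\le\|y\|_Y\le\rho_2\|y\|_{H^1(\Omega)}$ for all $y\in Y$. $Y^\ast$ is the dual of $Y$ with norm $\|l\|_{Y^\ast}=\sup_{\|v\|_Y=1}l(v)$. $U$ is a real Hilbert space with inner product $(\cdot,\cdot)_U$ and norm $\|\cdot\|_U$, and $U_{ad}\subseteq U$ is non-empty, closed and convex. $z\in L^2(\Omega_0)$ and $\alpha>0$ are given. For each $\mu\in\mathcal P$: $a(\cdot,\cdot;\mu):Y\times Y\to\mathbb R$ is bilinear with $$\gamma(\mu):=\sup_{y,v\in Y\setminus\{0\}}\frac{|a(y,v;\mu)|}{\|y\|_Y\|v\|_Y}\le\gamma_0<\infty,\qquad \beta(\mu):=\inf_{y\in Y\setminus\{0\}}\frac{a(y,y;\mu)}{\|y\|_Y^2}\ge\beta_0>0;$$ $b(\cdot,\cdot;\mu):U\times Y\to\mathbb R$ is bilinear with $$\kappa(\mu):=\sup_{u\in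 U\setminus\{0\},\,v\in Y\setminus\{0\}}\frac{|b(u,v;\mu)|}{\|u\|_U\|v\|_Y}\le\kappa_0<\infty;$$ $f(\cdot;\mu)\in Y^\ast$ with $\sup_{v\in Y\setminus\{0\}}|f(v;\mu)|/\|v\|_Y\le\sigma_0<\infty$. The constants $\gamma_0,\beta_0,\kappa_0,\sigma_0$ do not depend on $\mu$. The first system in the claim is the (necessary and sufficient) optimality system of the problem of minimizing $\frac12\|y-z\|_{L^2(\Omega_0)}^2+\frac\alpha2\|u\|_U^2$ over $(u,y)\in U_{ad}\times Y$ subject to $a(y,v;\mu)=b(u,v;\mu)+f(v;\mu)$ for all $v\in Y$; the second is that of the same problem with $Y$ replaced by $Y_N$ (the control still ranging over $U_{ad}$). Both problems have unique solutions. *)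

theory Defs
  imports "HOL-Analysis.Analysis" "HOL-Library.Function_Algebras"
begin

text \<open>Real-valued functions form a real vector space under the pointwise operations of
  \<^theory>\<open>HOL-Library.Function_Algebras\<close>; the interpretation makes subspaces and spans of
  functions available as \<open>fun_vs.subspace\<close> and \<open>fun_vs.span\<close>.\<close>

definition scaleF :: "real \<Rightarrow> ('a \<Rightarrow> real) \<Rightarrow> ('a \<Rightarrow> real)" where
  "scaleF c f = (\<lambda>x. c * f x)"

interpretation fun_vs: vector_space scaleF
  by standard (auto simp: scaleF_def fun_eq_iff algebra_simps)

definition finite_dim :: "('a \<Rightarrow> real) set \<Rightarrow> bool" where
  "finite_dim V \<longleftrightarrow> (\<exists>B. finite B \<and> V \<subseteq> fun_vs.span B)"


section \<open>Lebesgue and Sobolev spaces\<close>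

definition L2 :: "'a::euclidean_space set \<Rightarrow> ('a \<Rightarrow> real) set" where
  "L2 S = {f. set_borel_measurable lebesgue S f \<and> set_integrable lebesgue S (\<lambda>x. (f x)\<^sup>2)}"

definition L2_inner :: "'a::euclidean_space set \<Rightarrow> ('a \<Rightarrow> real) \<Rightarrow> ('a \<Rightarrow> real) \<Rightarrow> real" where
  "L2_inner S f g = (LINT x:S|lebesgue. f x * g x)"

definition partial_deriv :: "'d \<Rightarrow> (real^'d::finite \<Rightarrow> real) \<Rightarrow> (real^'d \<Rightarrow> real)" where
  "partial_deriv i f = (\<lambda>x. frechet_derivative f (at x) (axis i 1))"

primrec iterated_partial :: "'d list \<Rightarrow> (real^'d::finite \<Rightarrow> real) \<Rightarrow> (real^'d \<Rightarrow> real)" where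
  "iterated_partial [] f = f"
| "iterated_partial (i # is) f = partial_deriv i (iterated_partial is f)"

text \<open>If all iterated partial derivatives are differentiable everywhere, they are all
  continuous, so the functions below are exactly those in \<open>C\<^sub>c\<^sup>\<infinity>(\<Omega>)\<close>.\<close>

definition test_functions :: "(real^'d::finite) set \<Rightarrow> (real^'d \<Rightarrow> real) set" where
  "test_functions \<Omega> = {\<phi>. (\<forall>is x. iterated_partial is \<phi> differentiable at x) \<and>
     compact (closure {x. \<phi> x \<noteq> 0}) \<and> closure {x. \<phi> x \<noteq> 0} \<subseteq> \<Omega>}"

definition is_weak_partial ::
    "(real^'d::finite) set \<Rightarrow> 'd \<Rightarrow> (real^'d \<Rightarrow> real) \<Rightarrow> (real^'d \<Rightarrow> real) \<Rightarrow> bool" where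
  "is_weak_partial \<Omega> i f g \<longleftrightarrow>
     (\<forall>\<phi>\<in>test_functions \<Omega>. L2_inner \<Omega> f (partial_deriv i \<phi>) = - L2_inner \<Omega> g \<phi>)"

definition H1 :: "(real^'d::finite) set \<Rightarrow> (real^'d \<Rightarrow> real) set" where
  "H1 \<Omega> = {f \<in> L2 \<Omega>. \<forall>i. \<exists>g\<in>L2 \<Omega>. is_weak_partial \<Omega> i f g}"

text \<open>Weak derivatives are unique up to null sets, so the choice does not affect the norm.\<close>

definition weak_partial :: "(real^'d::finite) set \<Rightarrow> 'd \<Rightarrow> (real^'d \<Rightarrow> real) \<Rightarrow> (real^'d \<Rightarrow> real)" where
  "weak_partial \<Omega> i f = (SOME g. g \<in> L2 \<Omega> \<and> is_weak_partial \<Omega> i f g)"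

definition H1_norm :: "(real^'d::finite) set \<Rightarrow> (real^'d \<Rightarrow> real) \<Rightarrow> real" where
  "H1_norm \<Omega> f = sqrt (L2_inner \<Omega> f f +
     (\<Sum>i\<in>UNIV. L2_inner \<Omega> (weak_partial \<Omega> i f) (weak_partial \<Omega> i f)))"


section \<open>Piecewise linear continuous finite elements\<close>

text \<open>Functions on \<open>\<Omega>\<close> are total functions that vanish outside \<open>\<Omega>\<close>. As the elements of a
  finite element space are continuous on \<open>\<Omega>\<close>, two of them that agree almost everywhere on \<open>\<Omega>\<close>
  are then equal, so that a set of such functions is a genuine subset of \<open>H\<^sup>1(\<Omega>)\<close> and not only of
  a space of representatives. The mesh need only cover \<open>\<Omega>\<close>, which allows curved boundaries.\<close>

definition mesh :: "(real^'d::finite) set \<Rightarrow> (real^'d) set set \<Rightarrow> bool" where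
  "mesh \<Omega> \<T> \<longleftrightarrow> triangulation \<T> \<and> (\<forall>T\<in>\<T>. int CARD('d) simplex T) \<and> \<Omega> \<subseteq> \<Union>\<T>"

definition P1_elements :: "(real^'d::finite) set \<Rightarrow> (real^'d) set set \<Rightarrow> (real^'d \<Rightarrow> real) set" where
  "P1_elements \<Omega> \<T> = {y. continuous_on \<Omega> y \<and> (\<forall>x. x \<notin> \<Omega> \<longrightarrow> y x = 0) \<and>
     (\<forall>T\<in>\<T>. \<exists>w c. \<forall>x\<in>T \<inter> \<Omega>. y x = w \<bullet> x + c)}"

text \<open>Proper subspaces of the full piecewise linear space are allowed (e.g. because of
  essential boundary conditions).\<close>

definition P1_fe_space :: "(real^'d::finite) set \<Rightarrow> (real^'d \<Rightarrow> real) set \<Rightarrow> bool" where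
  "P1_fe_space \<Omega> Y \<longleftrightarrow> fun_vs.subspace Y \<and> finite_dim Y \<and> Y \<subseteq> H1 \<Omega> \<and>
     (\<exists>\<T>. mesh \<Omega> \<T> \<and> Y \<subseteq> P1_elements \<Omega> \<T>)"


section \<open>Forms on function spaces\<close>

definition linear_form_on :: "('a \<Rightarrow> real) set \<Rightarrow> (('a \<Rightarrow> real) \<Rightarrow> real) \<Rightarrow> bool" where
  "linear_form_on V l \<longleftrightarrow>
     (\<forall>v\<in>V. \<forall>w\<in>V. l (v + w) = l v + l w) \<and> (\<forall>c. \<forall>v\<in>V. l (scaleF c v) = c * l v)"

definition bilinear_form_on :: "('a \<Rightarrow> real) set \<Rightarrow> (('a \<Rightarrow> real) \<Rightarrow> ('a \<Rightarrow> real) \<Rightarrow> real) \<Rightarrow> bool" where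
  "bilinear_form_on V a \<longleftrightarrow>
     (\<forall>v\<in>V. linear_form_on V (\<lambda>y. a y v)) \<and> (\<forall>y\<in>V. linear_form_on V (a y))"

definition inner_product_on :: "('a \<Rightarrow> real) set \<Rightarrow> (('a \<Rightarrow> real) \<Rightarrow> ('a \<Rightarrow> real) \<Rightarrow> real) \<Rightarrow> bool" where
  "inner_product_on V ip \<longleftrightarrow> bilinear_form_on V ip \<and>
     (\<forall>v\<in>V. \<forall>w\<in>V. ip v w = ip w v) \<and> (\<forall>v\<in>V. v \<noteq> 0 \<longrightarrow> ip v v > 0)"

definition ip_norm :: "(('a \<Rightarrow> real) \<Rightarrow> ('a \<Rightarrow> real) \<Rightarrow> real) \<Rightarrow> ('a \<Rightarrow> real) \<Rightarrow> real" where
  "ip_norm ip v = sqrt (ip v v)"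

definition dual_norm ::
    "('a \<Rightarrow> real) set \<Rightarrow> (('a \<Rightarrow> real) \<Rightarrow> ('a \<Rightarrow> real) \<Rightarrow> real) \<Rightarrow> (('a \<Rightarrow> real) \<Rightarrow> real) \<Rightarrow> real" where
  "dual_norm Y ip l = Sup {l v | v. v \<in> Y \<and> ip_norm ip v = 1}"

text \<open>Suprema and infima of sets of reals are unspecified for unbounded sets. Hence the sets of
  quotients are named, and boundedness is stated next to each bound on a supremum or infimum.\<close>

definition a_quotients :: "('a \<Rightarrow> real) set \<Rightarrow> (('a \<Rightarrow> real) \<Rightarrow> ('a \<Rightarrow> real) \<Rightarrow> real) \<Rightarrow>
    (('a \<Rightarrow> real) \<Rightarrow> ('a \<Rightarrow> real) \<Rightarrow> real) \<Rightarrow> real set" where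
  "a_quotients Y ip a =
     {\<bar>a y v\<bar> / (ip_norm ip y * ip_norm ip v) | y v. y \<in> Y - {0} \<and> v \<in> Y - {0}}"

definition coercivity_quotients :: "('a \<Rightarrow> real) set \<Rightarrow> (('a \<Rightarrow> real) \<Rightarrow> ('a \<Rightarrow> real) \<Rightarrow> real) \<Rightarrow>
    (('a \<Rightarrow> real) \<Rightarrow> ('a \<Rightarrow> real) \<Rightarrow> real) \<Rightarrow> real set" where
  "coercivity_quotients Y ip a = {a y y / (ip_norm ip y)\<^sup>2 | y. y \<in> Y - {0}}"

definition b_quotients :: "('a \<Rightarrow> real) set \<Rightarrow> (('a \<Rightarrow> real) \<Rightarrow> ('a \<Rightarrow> real) \<Rightarrow> real) \<Rightarrow>
    ('u::real_normed_vector \<Rightarrow> ('a \<Rightarrow> real) \<Rightarrow> real) \<Rightarrow> real set" where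
  "b_quotients Y ip b =
     {\<bar>b u v\<bar> / (norm u * ip_norm ip v) | u v. u \<in> UNIV - {0} \<and> v \<in> Y - {0}}"

definition f_quotients :: "('a \<Rightarrow> real) set \<Rightarrow> (('a \<Rightarrow> real) \<Rightarrow> ('a \<Rightarrow> real) \<Rightarrow> real) \<Rightarrow>
    (('a \<Rightarrow> real) \<Rightarrow> real) \<Rightarrow> real set" where
  "f_quotients Y ip l = {\<bar>l v\<bar> / ip_norm ip v | v. v \<in> Y - {0}}"

definition continuity_const :: "('a \<Rightarrow> real) set \<Rightarrow> (('a \<Rightarrow> real) \<Rightarrow> ('a \<Rightarrow> real) \<Rightarrow> real) \<Rightarrow>
    (('a \<Rightarrow> real) \<Rightarrow> ('a \<Rightarrow> real) \<Rightarrow> real) \<Rightarrow> real" where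
  "continuity_const Y ip a = Sup (a_quotients Y ip a)"

definition coercivity_const :: "('a \<Rightarrow> real) set \<Rightarrow> (('a \<Rightarrow> real) \<Rightarrow> ('a \<Rightarrow> real) \<Rightarrow> real) \<Rightarrow>
    (('a \<Rightarrow> real) \<Rightarrow> ('a \<Rightarrow> real) \<Rightarrow> real) \<Rightarrow> real" where
  "coercivity_const Y ip a = Inf (coercivity_quotients Y ip a)"

definition control_const :: "('a \<Rightarrow> real) set \<Rightarrow> (('a \<Rightarrow> real) \<Rightarrow> ('a \<Rightarrow> real) \<Rightarrow> real) \<Rightarrow>
    ('u::real_normed_vector \<Rightarrow> ('a \<Rightarrow> real) \<Rightarrow> real) \<Rightarrow> real" where
  "control_const Y ip b = Sup (b_quotients Y ip b)"


section \<open>Optimality systems and the error estimator\<close>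

text \<open>\<open>V\<close> is the space of states, adjoint states and test functions: \<open>Y\<close> for the full system,
  \<open>Y\<^sub>N\<close> for the reduced one. The control ranges over \<open>Uad\<close> in both cases.\<close>

definition optimality_system ::
    "'a::euclidean_space set \<Rightarrow> ('a \<Rightarrow> real) \<Rightarrow> real \<Rightarrow> 'u::real_inner set \<Rightarrow> ('a \<Rightarrow> real) set \<Rightarrow>
     (('a \<Rightarrow> real) \<Rightarrow> ('a \<Rightarrow> real) \<Rightarrow> real) \<Rightarrow> ('u \<Rightarrow> ('a \<Rightarrow> real) \<Rightarrow> real) \<Rightarrow>
     (('a \<Rightarrow> real) \<Rightarrow> real) \<Rightarrow> 'u \<Rightarrow> ('a \<Rightarrow> real) \<Rightarrow> ('a \<Rightarrow> real) \<Rightarrow> bool" where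
  "optimality_system \<Omega>\<^sub>0 z \<alpha> Uad V a b f u y p \<longleftrightarrow>
     u \<in> Uad \<and> y \<in> V \<and> p \<in> V \<and>
     (\<forall>v\<in>V. a y v = b u v + f v) \<and>
     (\<forall>v\<in>V. a v p = L2_inner \<Omega>\<^sub>0 (y - z) v) \<and>
     (\<forall>v\<in>Uad. b (v - u) p + \<alpha> * (u \<bullet> (v - u)) \<ge> 0)"

definition state_residual ::
    "(('a \<Rightarrow> real) \<Rightarrow> ('a \<Rightarrow> real) \<Rightarrow> real) \<Rightarrow> ('u \<Rightarrow> ('a \<Rightarrow> real) \<Rightarrow> real) \<Rightarrow> (('a \<Rightarrow> real) \<Rightarrow> real) \<Rightarrow>
     'u \<Rightarrow> ('a \<Rightarrow> real) \<Rightarrow> ('a \<Rightarrow> real) \<Rightarrow> real" where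
  "state_residual a b f u\<^sub>N y\<^sub>N = (\<lambda>v. b u\<^sub>N v + f v - a y\<^sub>N v)"

definition adjoint_residual ::
    "'a::euclidean_space set \<Rightarrow> ('a \<Rightarrow> real) \<Rightarrow> (('a \<Rightarrow> real) \<Rightarrow> ('a \<Rightarrow> real) \<Rightarrow> real) \<Rightarrow>
     ('a \<Rightarrow> real) \<Rightarrow> ('a \<Rightarrow> real) \<Rightarrow> ('a \<Rightarrow> real) \<Rightarrow> real" where
  "adjoint_residual \<Omega>\<^sub>0 z a y\<^sub>N p\<^sub>N = (\<lambda>v. L2_inner \<Omega>\<^sub>0 (y\<^sub>N - z) v - a v p\<^sub>N)"

definition control_error_bound ::
    "'a::euclidean_space set \<Rightarrow> ('a \<Rightarrow> real) \<Rightarrow> real \<Rightarrow> real \<Rightarrow> ('a \<Rightarrow> real) set \<Rightarrow>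
     (('a \<Rightarrow> real) \<Rightarrow> ('a \<Rightarrow> real) \<Rightarrow> real) \<Rightarrow> (('a \<Rightarrow> real) \<Rightarrow> ('a \<Rightarrow> real) \<Rightarrow> real) \<Rightarrow>
     ('u::real_normed_vector \<Rightarrow> ('a \<Rightarrow> real) \<Rightarrow> real) \<Rightarrow> (('a \<Rightarrow> real) \<Rightarrow> real) \<Rightarrow>
     'u \<Rightarrow> ('a \<Rightarrow> real) \<Rightarrow> ('a \<Rightarrow> real) \<Rightarrow> real" where
  "control_error_bound \<Omega>\<^sub>0 z \<alpha> \<rho>\<^sub>1 Y ip a b f u\<^sub>N y\<^sub>N p\<^sub>N =
     1 / (\<rho>\<^sub>1 * sqrt \<alpha> * coercivity_const Y ip a) *
       dual_norm Y ip (state_residual a b f u\<^sub>N y\<^sub>N) +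
     control_const Y ip b / (\<alpha> * coercivity_const Y ip a) *
       dual_norm Y ip (adjoint_residual \<Omega>\<^sub>0 z a y\<^sub>N p\<^sub>N)"

end

theory Submission
  imports Defs
begin

text \<open>Let \<open>y'\<close> and \<open>p'\<close> be the discrete state and adjoint state obtained on all of \<open>Y\<close> from the data
  \<open>u\<^sub>N\<close> and \<open>y\<^sub>N\<close>. By coercivity, \<open>y' - y\<^sub>N\<close> and \<open>p' - p\<^sub>N\<close> are controlled by the residuals.
  Testing each variational inequality with the other control gives
  \<open>\<alpha> \<parallel>u - u\<^sub>N\<parallel>\<^sup>2 \<le> b(u - u\<^sub>N, p\<^sub>N - p') + b(u - u\<^sub>N, p' - p)\<close>, and the last term equals
  \<open>(y\<^sub>N - y, y - y')\<close>, which is at most \<open>\<parallel>y\<^sub>N - y'\<parallel>\<^sup>2 / 4\<close>. The resulting quadratic inequality yields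
  \<open>\<parallel>u - u\<^sub>N\<parallel> \<le> \<Delta>\<^sub>u\<close>; then \<open>\<parallel>u\<parallel> \<ge> \<parallel>u\<^sub>N\<parallel> / 2\<close>, which turns the absolute bound into the relative one.\<close>

section \<open>Square-integrable functions\<close>

text \<open>The product is dominated through |s t| <= s^2 + t^2. Non-integrable functions have
  Bochner integral 0, so this integrability is what makes \<open>L2_inner\<close> additive.
  Measurability concerns only the products with the indicator, hence the cut-off functions.\<close>

lemma L2_mult_integrable:
  assumes "f \<in> L2 S" "g \<in> L2 S"
  shows "set_integrable lebesgue S (\<lambda>x. f x * g x)"
proof -
  let ?f = "\<lambda>x. indicator S x * f x" and ?g = "\<lambda>x. indicator S x * g x"
  have m: "?f \<in> borel_measurable lebesgue" "?g \<in> borel_measurable lebesgue"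
    using assms by (auto simp: L2_def set_borel_measurable_def)
  have i: "integrable lebesgue (\<lambda>x. indicator S x * (f x)\<^sup>2 + indicator S x * (g x)\<^sup>2)"
    using assms by (auto simp: L2_def set_integrable_def)
  have "integrable lebesgue (\<lambda>x. ?f x * ?g x)"
  proof (rule Bochner_Integration.integrable_bound[OF i])
    show "(\<lambda>x. ?f x * ?g x) \<in> borel_measurable lebesgue"
      using m by measurable
    have "\<bar>s * t\<bar> \<le> s\<^sup>2 + t\<^sup>2" for s t :: real
      using sum_squares_bound[of "\<bar>s\<bar>" "\<bar>t\<bar>"] abs_ge_zero[of "s * t"]
      unfolding abs_mult power2_abs by linarith
    then show "AE x in lebesgue. norm (?f x * ?g x)
        \<le> norm (indicator S x * (f x)\<^sup>2 + indicator S x * (g x)\<^sup>2)"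
      by (intro always_eventually) (auto simp: indicator_def)
  qed
  moreover have "?f x * ?g x = indicator S x *\<^sub>R (f x * g x)" for x
    by (auto simp: indicator_def)
  ultimately show ?thesis
    by (simp add: set_integrable_def)
qed

lemma L2_add:
  assumes "f \<in> L2 S" "g \<in> L2 S"
  shows "f + g \<in> L2 S"
proof -
  have "set_integrable lebesgue S (\<lambda>x. (f x)\<^sup>2 + (g x)\<^sup>2 + 2 * (f x * g x))"
    using assms L2_mult_integrable[OF assms]
    by (intro set_integral_add set_integrable_mult_right) (auto simp: L2_def)
  moreover have "(\<lambda>x. indicator S x *\<^sub>R (f + g) x) \<in> borel_measurable lebesgue"
    using borel_measurable_add[of "\<lambda>x. indicator S x *\<^sub>R f x" lebesgue "\<lambda>x. indicator S x *\<^sub>R g x"]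
      assms
    by (auto simp: L2_def set_borel_measurable_def distrib_left)
  ultimately show ?thesis
    by (simp add: L2_def set_borel_measurable_def power2_sum algebra_simps)
qed

lemma L2_scale:
  assumes "f \<in> L2 S"
  shows "scaleF c f \<in> L2 S"
proof -
  have "(\<lambda>x. c * (indicator S x * f x)) \<in> borel_measurable lebesgue"
    by (intro borel_measurable_times[OF borel_measurable_const])
      (use assms in \<open>simp add: L2_def set_borel_measurable_def\<close>)
  then show ?thesis
    using assms
    by (auto simp: L2_def set_borel_measurable_def scaleF_def power_mult_distrib ac_simps)
qed

lemma L2_diff:
  assumes "f \<in> L2 S" "g \<in> L2 S"
  shows "f - g \<in> L2 S"
  using L2_add[OF assms(1) L2_scale[OF assms(2), of "- 1"]] by simp

lemma L2_mono:
  assumes "f \<in> L2 S" "T \<in> sets lebesgue" "T \<subseteq> S"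
  shows "f \<in> L2 T"
  using assms set_borel_measurable_subset[of lebesgue S f T]
    set_integrable_subset[of lebesgue S _ T]
  by (auto simp: L2_def)

lemma L2_inner_commute: "L2_inner S f g = L2_inner S g f"
  by (simp add: L2_inner_def mult.commute)

lemma L2_inner_add_right:
  assumes "f \<in> L2 S" "g \<in> L2 S" "h \<in> L2 S"
  shows "L2_inner S f (g + h) = L2_inner S f g + L2_inner S f h"
  using L2_mult_integrable[OF assms(1,2)] L2_mult_integrable[OF assms(1,3)]
  by (simp add: L2_inner_def distrib_left set_integral_add)

text \<open>A constant factor leaves the Bochner integral even for a non-integrable product, where
  both sides are 0.\<close>

lemma L2_inner_scale_right: "L2_inner S f (scaleF c g) = c * L2_inner S f g"
proof -
  have "L2_inner S f (scaleF c g) = (LINT x:S|lebesgue. c * (f x * g x))"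
    by (simp add: L2_inner_def scaleF_def ac_simps)
  then show ?thesis
    by (simp add: L2_inner_def)
qed

lemma L2_inner_diff_right:
  assumes "f \<in> L2 S" "g \<in> L2 S" "h \<in> L2 S"
  shows "L2_inner S f (g - h) = L2_inner S f g - L2_inner S f h"
  using L2_inner_add_right[OF assms(1,2) L2_scale[OF assms(3), of "- 1"]]
    L2_inner_scale_right[of S f "- 1" h]
  by simp

lemma L2_inner_diff_left:
  assumes "f \<in> L2 S" "g \<in> L2 S" "h \<in> L2 S"
  shows "L2_inner S (f - g) h = L2_inner S f h - L2_inner S g h"
  using L2_inner_diff_right[OF assms(3,1,2)] by (simp add: L2_inner_commute)

text \<open>Valid for every \<open>f\<close>, since a non-integrable square has integral 0. It
  therefore applies to \<open>weak_partial\<close> without looking into the choice that defines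
  it.\<close>

lemma L2_inner_self_nonneg: "0 \<le> L2_inner S f f"
  by (auto simp: L2_inner_def set_lebesgue_integral_def intro!: Bochner_Integration.integral_nonneg)

lemma L2_inner_self_mono:
  assumes "f \<in> L2 S" "T \<in> sets lebesgue" "T \<subseteq> S"
  shows "L2_inner T f f \<le> L2_inner S f f"
  unfolding L2_inner_def set_lebesgue_integral_def
proof (rule integral_mono)
  show "integrable lebesgue (\<lambda>x. indicator T x *\<^sub>R (f x * f x))"
    using L2_mult_integrable[OF L2_mono[OF assms] L2_mono[OF assms]] by (simp add: set_integrable_def)
  show "integrable lebesgue (\<lambda>x. indicator S x *\<^sub>R (f x * f x))"
    using L2_mult_integrable[OF assms(1,1)] by (simp add: set_integrable_def)
  show "indicator T x *\<^sub>R (f x * f x) \<le> indicator S x *\<^sub>R (f x * f x)" for x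
    using assms(3) by (auto simp: indicator_def)
qed

text \<open>Dropping the derivative terms and shrinking the domain only decreases the sum under the
  root. This links the observation on a subdomain to the norm equivalence with constant
  \<open>\<rho>\<^sub>1\<close>.\<close>

lemma L2_inner_self_le_H1_norm:
  assumes "f \<in> L2 \<Omega>" "T \<in> sets lebesgue" "T \<subseteq> \<Omega>"
  shows "L2_inner T f f \<le> (H1_norm \<Omega> f)\<^sup>2"
proof -
  have "0 \<le> (\<Sum>i\<in>UNIV. L2_inner \<Omega> (weak_partial \<Omega> i f) (weak_partial \<Omega> i f))"
    by (intro sum_nonneg L2_inner_self_nonneg)
  then show ?thesis
    using L2_inner_self_mono[OF assms] L2_inner_self_nonneg[of \<Omega> f]
    by (simp add: H1_norm_def)
qed


section \<open>Forms on subspaces\<close>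

lemma linear_form_on_diff:
  assumes "fun_vs.subspace V" "linear_form_on V l" "v \<in> V" "w \<in> V"
  shows "l (v - w) = l v - l w"
proof -
  have "scaleF (- 1) w \<in> V"
    using assms by (intro fun_vs.subspace_scale)
  then have "l (v + scaleF (- 1) w) = l v + l (scaleF (- 1) w)"
    using assms by (auto simp: linear_form_on_def)
  also have "l (scaleF (- 1) w) = - 1 * l w"
    using assms unfolding linear_form_on_def by blast
  also have "v + scaleF (- 1) w = v - w"
    by simp
  finally show ?thesis
    by linarith
qed

lemma linear_form_on_subset: "linear_form_on V l \<Longrightarrow> W \<subseteq> V \<Longrightarrow> linear_form_on W l"
  by (auto simp: linear_form_on_def subset_iff)

lemma bilinear_form_on_subset: "bilinear_form_on V a \<Longrightarrow> W \<subseteq> V \<Longrightarrow> bilinear_form_on W a"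
  by (auto simp: bilinear_form_on_def linear_form_on_def subset_iff)

lemma bilinear_form_on_flip: "bilinear_form_on V a \<Longrightarrow> bilinear_form_on V (\<lambda>y v. a v y)"
  by (auto simp: bilinear_form_on_def)

text \<open>Existence is by induction on a spanning set: the new vector is made orthogonal, with respect
  to the form, to the test functions already treated, so that a multiple of it can be added without
  affecting their equations.\<close>

lemma Lax_Milgram_span:
  assumes "finite B" "bilinear_form_on (fun_vs.span B) a" "linear_form_on (fun_vs.span B) l"
    and "\<And>v. v \<in> fun_vs.span B \<Longrightarrow> v \<noteq> 0 \<Longrightarrow> a v v \<noteq> 0"
  shows "\<exists>y\<in>fun_vs.span B. \<forall>v\<in>fun_vs.span B. a y v = l v"
  using assms
proof (induction B arbitrary: l rule: finite_induct)
  case empty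
  have l: "linear_form_on {0} g \<Longrightarrow> g 0 = 0" for g :: "('a \<Rightarrow> real) \<Rightarrow> real"
    by (fastforce simp: linear_form_on_def)
  have "a 0 0 = 0" "l 0 = 0"
    using empty l[of "a 0"] l[of l] by (auto simp: bilinear_form_on_def)
  then have "a 0 0 = l 0"
    by simp
  then show ?case
    unfolding fun_vs.span_empty by blast
next
  case (insert w B)
  let ?V = "fun_vs.span B" and ?W = "fun_vs.span (insert w B)"
  have sub: "?V \<subseteq> ?W"
    by (intro fun_vs.span_mono) auto
  have wW: "w \<in> ?W"
    by (simp add: fun_vs.span_base)
  have linW: "linear_form_on ?W (a q)" "linear_form_on ?W (\<lambda>q'. a q' q)" if "q \<in> ?W" for q
    using insert.prems(1) that by (auto simp: bilinear_form_on_def)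
  have IH: "\<exists>y\<in>?V. \<forall>v\<in>?V. a y v = g v" if "linear_form_on ?W g" for g
    using insert.prems(3) sub
    by (intro insert.IH bilinear_form_on_subset[OF insert.prems(1)] linear_form_on_subset[OF that]) auto
  show ?case
  proof (cases "w \<in> ?V")
    case True
    then have "?W = ?V"
      by (rule fun_vs.span_redundant)
    then show ?thesis
      using IH[OF insert.prems(2)] by simp
  next
    case False
    obtain q where q: "q \<in> ?V" "\<And>v. v \<in> ?V \<Longrightarrow> a q v = a w v"
      using IH[OF linW(1)[OF wW]] by blast
    obtain y where y: "y \<in> ?V" "\<And>v. v \<in> ?V \<Longrightarrow> a y v = l v"
      using IH[OF insert.prems(2)] by blast
    define w' where "w' = w - q"
    have w': "w' \<in> ?W" "w' \<noteq> 0"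
      using q(1) sub wW False by (auto simp: w'_def intro: fun_vs.span_diff)
    have orth: "a w' v = 0" if "v \<in> ?V" for v
      using linear_form_on_diff[OF fun_vs.subspace_span linW(2), of v w q] that q sub wW
      by (auto simp: w'_def)
    \<comment> \<open>This \<open>c\<close> solves the equation tested with \<open>w'\<close>,
      namely a(y, w') + c a(w', w') = l(w'). The denominator is nonzero because \<open>w\<close>
      lies outside the old span while \<open>q\<close> lies in it.\<close>
    define c where "c = (l w' - a y w') / a w' w'"
    have cw: "scaleF c w' \<in> ?W"
      using w' by (intro fun_vs.span_scale)
    have test: "a (y + scaleF c w') v = a y v + c * a w' v" if "v \<in> ?W" for v
      using linW(2)[OF that] w' cw y(1) sub by (auto simp: linear_form_on_def subset_iff)
    have "a (y + scaleF c w') v = l v" if v: "v \<in> ?W" for v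
    proof -
      obtain k where k: "v - scaleF k w \<in> ?V"
        using v by (auto simp: fun_vs.span_insert)
      \<comment> \<open>Every test vector splits as \<open>v\<^sub>0 + scaleF k w'\<close> with
        \<open>v\<^sub>0\<close> in the old span, so the equation need only be compared on these two
        summands.\<close>
      define v\<^sub>0 where "v\<^sub>0 = v - scaleF k w'"
      have "v\<^sub>0 = (v - scaleF k w) + scaleF k q"
        by (simp add: v\<^sub>0_def w'_def fun_vs.scale_right_diff_distrib)
      then have v\<^sub>0: "v\<^sub>0 \<in> ?V"
        using k q(1) by (simp add: fun_vs.span_add fun_vs.span_scale)
      have kw: "scaleF k w' \<in> ?W"
        using w' by (intro fun_vs.span_scale)
      have split: "g v = g v\<^sub>0 + k * g w'" if g: "linear_form_on ?W g" for g
      proof -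
        have "g (v\<^sub>0 + scaleF k w') = g v\<^sub>0 + g (scaleF k w')"
          using g v\<^sub>0 sub kw by (auto simp: linear_form_on_def)
        also have "g (scaleF k w') = k * g w'"
          using g w'(1) unfolding linear_form_on_def by blast
        also have "v\<^sub>0 + scaleF k w' = v"
          by (simp add: v\<^sub>0_def)
        finally show ?thesis .
      qed
      have "a w' v = k * a w' w'"
        using split[OF linW(1)[OF w'(1)]] orth[OF v\<^sub>0] by simp
      moreover have "a y v = l v\<^sub>0 + k * a y w'"
        using split[OF linW(1)] y sub v\<^sub>0 by auto
      moreover have "l v = l v\<^sub>0 + k * l w'"
        by (rule split[OF insert.prems(2)])
      moreover have "c * (k * a w' w') = k * (l w' - a y w')"
        using insert.prems(3)[OF w'] by (simp add: c_def)
      ultimately show ?thesis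
        using test[OF v] by (simp add: algebra_simps)
    qed
    moreover have "y + scaleF c w' \<in> ?W"
      using y(1) sub cw by (auto intro: fun_vs.span_add)
    ultimately show ?thesis
      by blast
  qed
qed

text \<open>The generators granted by \<open>finite_dim\<close> may lie outside \<open>V\<close>. A
  maximal independent subset of \<open>V\<close> spans \<open>V\<close> and, being independent in
  the span of finitely many generators, is finite.\<close>

lemma finite_dim_subspace_span:
  assumes "fun_vs.subspace V" "finite_dim V"
  obtains B where "finite B" "V = fun_vs.span B"
proof -
  obtain C where C: "finite C" "V \<subseteq> fun_vs.span C"
    using assms(2) by (auto simp: finite_dim_def)
  obtain B where B: "B \<subseteq> V" "fun_vs.independent B" "V \<subseteq> fun_vs.span B"
    using fun_vs.maximal_independent_subset[of V] by blast
  have "B \<subseteq> fun_vs.span C"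
    using B(1) C(2) by blast
  then have "finite B"
    using fun_vs.independent_span_bound[OF C(1) B(2)] by blast
  moreover have "V = fun_vs.span B"
    using B fun_vs.span_minimal[OF B(1) assms(1)] by blast
  ultimately show ?thesis
    using that by blast
qed

lemma Lax_Milgram:
  assumes "fun_vs.subspace V" "finite_dim V" "bilinear_form_on V a" "linear_form_on V l"
    and "\<And>v. v \<in> V \<Longrightarrow> v \<noteq> 0 \<Longrightarrow> a v v \<noteq> 0"
  obtains y where "y \<in> V" "\<And>v. v \<in> V \<Longrightarrow> a y v = l v"
proof -
  obtain B where "finite B" "V = fun_vs.span B"
    using finite_dim_subspace_span[OF assms(1,2)] .
  then have "\<exists>y\<in>V. \<forall>v\<in>V. a y v = l v"
    using Lax_Milgram_span[of B a l] assms by auto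
  then show ?thesis
    using that by blast
qed

section \<open>The norm of the inner product and its dual norm\<close>

lemma ip_norm_zero:
  assumes "fun_vs.subspace V" "inner_product_on V ip"
  shows "ip_norm ip 0 = 0"
proof -
  have "0 \<in> V"
    using assms(1) by (rule fun_vs.subspace_0)
  \<comment> \<open>\<open>inner_product_on\<close> demands positivity only away from 0, so the
    value at 0 has to come from linearity.\<close>
  then have "linear_form_on V (ip 0)"
    using assms(2) by (auto simp: inner_product_on_def bilinear_form_on_def)
  from linear_form_on_diff[OF assms(1) this \<open>0 \<in> V\<close> \<open>0 \<in> V\<close>] show ?thesis
    by (simp add: ip_norm_def)
qed

lemma ip_norm_pos: "inner_product_on V ip \<Longrightarrow> v \<in> V \<Longrightarrow> v \<noteq> 0 \<Longrightarrow> 0 < ip_norm ip v"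
  by (simp add: inner_product_on_def ip_norm_def)

lemma ip_norm_scale:
  assumes "fun_vs.subspace V" "inner_product_on V ip" "v \<in> V"
  shows "ip_norm ip (scaleF c v) = \<bar>c\<bar> * ip_norm ip v"
proof -
  have cv: "scaleF c v \<in> V"
    using assms by (intro fun_vs.subspace_scale)
  have lin: "linear_form_on V (ip (scaleF c v))" "linear_form_on V (\<lambda>w. ip w v)"
    using assms cv by (auto simp: inner_product_on_def bilinear_form_on_def)
  have "ip (scaleF c v) (scaleF c v) = c * ip (scaleF c v) v"
    using lin(1) assms(3) unfolding linear_form_on_def by blast
  also have "ip (scaleF c v) v = c * ip v v"
    using lin(2) assms(3) by (simp add: linear_form_on_def)
  finally have "ip (scaleF c v) (scaleF c v) = c\<^sup>2 * ip v v"
    by (simp add: power2_eq_square)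
  then show ?thesis
    by (simp add: ip_norm_def real_sqrt_mult)
qed

lemma linear_form_on_zero:
  assumes "fun_vs.subspace V" "linear_form_on V l"
  shows "l 0 = 0"
  using linear_form_on_diff[OF assms, of 0 0] fun_vs.subspace_0[OF assms(1)] by simp

context
  fixes V :: "('a \<Rightarrow> real) set" and ip :: "('a \<Rightarrow> real) \<Rightarrow> ('a \<Rightarrow> real) \<Rightarrow> real"
  assumes V: "fun_vs.subspace V" and ip: "inner_product_on V ip"
begin

text \<open>Rescale \<open>v\<close> to the unit sphere. The constant \<open>C\<close> serves only
  to bound the set of values there, so that its \<open>Sup\<close> is an upper bound.\<close>

lemma le_dual_norm:
  assumes l: "linear_form_on V l" and "\<And>v. v \<in> V \<Longrightarrow> l v \<le> C * ip_norm ip v" and v: "v \<in> V"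
  shows "l v \<le> dual_norm V ip l * ip_norm ip v"
proof (cases "v = 0")
  case True
  then show ?thesis
    using linear_form_on_zero[OF V l] ip_norm_zero[OF V ip] by simp
next
  case False
  define w where "w = scaleF (1 / ip_norm ip v) v"
  have pos: "0 < ip_norm ip v"
    using ip_norm_pos[OF ip v False] .
  have w: "w \<in> V" "ip_norm ip w = 1"
    using V v pos by (auto simp: w_def ip_norm_scale[OF V ip v] fun_vs.subspace_scale)
  have "bdd_above {l v | v. v \<in> V \<and> ip_norm ip v = 1}"
    using assms(2) by (intro bdd_aboveI[of _ C]) fastforce
  then have "l w \<le> dual_norm V ip l"
    unfolding dual_norm_def using w by (intro cSup_upper) auto
  moreover have "l w = 1 / ip_norm ip v * l v"
    using l v unfolding linear_form_on_def w_def by blast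
  ultimately show ?thesis
    using pos by (simp add: field_simps)
qed

text \<open>A nonzero \<open>v\<close> and its negative give opposite values of \<open>l\<close>;
  adding the two dual norm estimates leaves 0 on the left.\<close>

lemma dual_norm_nonneg:
  assumes l: "linear_form_on V l" and "\<And>v. v \<in> V \<Longrightarrow> l v \<le> C * ip_norm ip v" and "V \<noteq> {0}"
  shows "0 \<le> dual_norm V ip l"
proof -
  obtain v where v: "v \<in> V" "v \<noteq> 0"
    using assms(3) fun_vs.subspace_0[OF V] by blast
  have v': "scaleF (- 1) v \<in> V"
    using V v by (intro fun_vs.subspace_scale)
  have "l (scaleF (- 1) v) = - 1 * l v"
    using l v unfolding linear_form_on_def by blast
  then have "0 \<le> 2 * (dual_norm V ip l * ip_norm ip v)"
    using le_dual_norm[OF assms(1,2) v(1)] le_dual_norm[OF assms(1,2) v'] ip_norm_scale[OF V ip v(1), of "- 1"]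
    by simp
  then show ?thesis
    using ip_norm_pos[OF ip v] by (simp add: zero_le_mult_iff)
qed

section \<open>Estimates by the continuity, coercivity and control constants\<close>

lemma abs_le_continuity_const:
  assumes "bilinear_form_on V a" "bdd_above (a_quotients V ip a)" "y \<in> V" "v \<in> V"
  shows "\<bar>a y v\<bar> \<le> continuity_const V ip a * (ip_norm ip y * ip_norm ip v)"
proof (cases "y = 0 \<or> v = 0")
  \<comment> \<open>The quotients exclude zero arguments; there both sides vanish by
    linearity.\<close>
  case True
  have "linear_form_on V (\<lambda>y. a y v)" "linear_form_on V (a y)"
    using assms by (auto simp: bilinear_form_on_def)
  then show ?thesis
    using True ip_norm_zero[OF V ip] linear_form_on_zero[OF V, of "\<lambda>y. a y v"]
      linear_form_on_zero[OF V, of "a y"] by auto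
next
  case False
  then have "0 < ip_norm ip y * ip_norm ip v"
    using assms ip_norm_pos[OF ip] by simp
  moreover have "\<bar>a y v\<bar> / (ip_norm ip y * ip_norm ip v) \<le> continuity_const V ip a"
    unfolding continuity_const_def using assms False
    by (intro cSup_upper) (auto simp: a_quotients_def)
  ultimately show ?thesis
    by (simp add: pos_divide_le_eq)
qed

lemma coercivity_const_le:
  assumes "bilinear_form_on V a" "bdd_below (coercivity_quotients V ip a)" "y \<in> V"
  shows "coercivity_const V ip a * (ip_norm ip y)\<^sup>2 \<le> a y y"
proof (cases "y = 0")
  case True
  have "linear_form_on V (a y)"
    using assms by (auto simp: bilinear_form_on_def)
  then show ?thesis
    using True ip_norm_zero[OF V ip] linear_form_on_zero[OF V, of "a y"] by simp
next
  case False
  then have "0 < (ip_norm ip y)\<^sup>2"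
    using assms by (intro zero_less_power ip_norm_pos[OF ip])
  moreover have "coercivity_const V ip a \<le> a y y / (ip_norm ip y)\<^sup>2"
    unfolding coercivity_const_def using assms False
    by (intro cInf_lower) (auto simp: coercivity_quotients_def)
  ultimately show ?thesis
    by (simp add: pos_le_divide_eq)
qed

lemma abs_le_control_const:
  fixes b :: "'u::real_normed_vector \<Rightarrow> ('a \<Rightarrow> real) \<Rightarrow> real"
  assumes "linear (\<lambda>w. b w v)" "linear_form_on V (b w)" "bdd_above (b_quotients V ip b)" "v \<in> V"
  shows "\<bar>b w v\<bar> \<le> control_const V ip b * (norm w * ip_norm ip v)"
proof (cases "w = 0 \<or> v = 0")
  case True
  then show ?thesis
    using ip_norm_zero[OF V ip] linear_0[OF assms(1)] linear_form_on_zero[OF V assms(2)] by auto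
next
  case False
  then have "0 < norm w * ip_norm ip v"
    using assms ip_norm_pos[OF ip] by simp
  moreover have "\<bar>b w v\<bar> / (norm w * ip_norm ip v) \<le> control_const V ip b"
    unfolding control_const_def using assms False
    by (intro cSup_upper) (auto simp: b_quotients_def)
  ultimately show ?thesis
    by (simp add: pos_divide_le_eq)
qed

text \<open>A \<open>Sup\<close> says something only for a nonempty set: nonzero \<open>w\<close>
  and \<open>v\<close> provide one quotient, and it is nonnegative.\<close>

lemma control_const_nonneg:
  fixes b :: "'u::real_normed_vector \<Rightarrow> ('a \<Rightarrow> real) \<Rightarrow> real" and w :: 'u
  assumes "bdd_above (b_quotients V ip b)" "w \<noteq> 0" "V \<noteq> {0}"
  shows "0 \<le> control_const V ip b"
proof -
  obtain v where v: "v \<in> V" "v \<noteq> 0"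
    using assms(3) fun_vs.subspace_0[OF V] by blast
  have "0 \<le> \<bar>b w v\<bar> / (norm w * ip_norm ip v)"
    using ip_norm_pos[OF ip v] by simp
  also have "\<dots> \<le> control_const V ip b"
    unfolding control_const_def using assms v by (intro cSup_upper) (auto simp: b_quotients_def)
  finally show ?thesis .
qed

text \<open>Testing with the error itself gives \<beta> |e|^2 <= a(e, e) = r(e) <= |r| |e|. The two
  alternatives for \<open>r\<close> serve the state and the adjoint equation. Continuity of
  \<open>a\<close> makes the dual norm of \<open>r\<close> a genuine supremum.\<close>

lemma norm_le_residual:
  assumes a: "bilinear_form_on V a" and "bdd_above (a_quotients V ip a)"
    and coer: "bdd_below (coercivity_quotients V ip a)" "0 < coercivity_const V ip a"
    and e: "e \<in> V" and "V \<noteq> {0}"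
    and r: "(\<forall>v\<in>V. r v = a e v) \<or> (\<forall>v\<in>V. r v = a v e)"
  shows "coercivity_const V ip a * ip_norm ip e \<le> dual_norm V ip r \<and> 0 \<le> dual_norm V ip r"
proof -
  have lin: "linear_form_on V r"
    using a e r fun_vs.subspace_add[OF V] fun_vs.subspace_scale[OF V]
    by (auto simp: bilinear_form_on_def linear_form_on_def)
  have "r v \<le> continuity_const V ip a * ip_norm ip e * ip_norm ip v" if v: "v \<in> V" for v
    using r abs_le_continuity_const[OF a assms(2) e v] abs_le_continuity_const[OF a assms(2) v e] v
    by (auto simp: ac_simps abs_le_iff)
  note bound = le_dual_norm[OF lin this e] and nn = dual_norm_nonneg[OF lin this \<open>V \<noteq> {0}\<close>]
  have "coercivity_const V ip a * (ip_norm ip e)\<^sup>2 \<le> dual_norm V ip r * ip_norm ip e"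
    using coercivity_const_le[OF a coer(1) e] bound r e by auto
  then have "coercivity_const V ip a * ip_norm ip e \<le> dual_norm V ip r" if "e \<noteq> 0"
    using ip_norm_pos[OF ip e that] by (simp add: power2_eq_square)
  then show ?thesis
    using nn ip_norm_zero[OF V ip] by (cases "e = 0") auto
qed

end


section \<open>The control error\<close>

text \<open>If x exceeded the bound, then x - B/\<alpha> and x would both be at least C / sqrt
  \<alpha>, so \<alpha> x^2 - B x >= C^2. This contradicts the bound C^2 / 4 unless C = 0, and then
  \<alpha> x <= B already contradicts the assumption.\<close>

lemma quadratic_inequality_bound:
  fixes x :: real
  assumes "\<alpha> > 0" "0 \<le> B" "0 \<le> C" "\<alpha> * x\<^sup>2 \<le> B * x + C\<^sup>2 / 4"
  shows "x \<le> C / sqrt \<alpha> + B / \<alpha>"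
proof (rule ccontr)
  assume *: "\<not> ?thesis"
  define s where "s = sqrt \<alpha>"
  have s: "s > 0" "\<alpha> = s\<^sup>2"
    using assms by (auto simp: s_def)
  have x: "C / s + B / \<alpha> < x"
    using * by (simp add: s_def)
  have nn: "0 \<le> C / s" "0 \<le> B / \<alpha>"
    using assms s by auto
  have "C / s * (C / s) \<le> (x - B / \<alpha>) * x"
    using x nn by (intro mult_mono) auto
  then have "\<alpha> * (C / s * (C / s)) \<le> \<alpha> * ((x - B / \<alpha>) * x)"
    using assms(1) by (intro mult_left_mono) auto
  also have "\<alpha> * (C / s * (C / s)) = C\<^sup>2"
    using s by (simp add: power2_eq_square)
  also have "\<alpha> * ((x - B / \<alpha>) * x) = \<alpha> * x\<^sup>2 - B * x"
    using assms(1) by (simp add: field_simps power2_eq_square)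
  finally have "C\<^sup>2 \<le> C\<^sup>2 / 4"
    using assms(4) by linarith
  then have C0: "C = 0"
    using zero_le_power2[of C] by (simp add: field_simps)
  then have "\<alpha> * x \<le> B"
    using assms(4) x nn by (simp add: power2_eq_square)
  then show False
    using x C0 assms(1) by (simp add: field_simps)
qed

lemma control_error_le:
  fixes \<Omega> \<Omega>\<^sub>0 :: "(real^'d::finite) set" and u u\<^sub>N :: "'u::real_inner"
  assumes Y: "fun_vs.subspace Y" "finite_dim Y" "Y \<subseteq> L2 \<Omega>" "Y \<noteq> {0}"
    and \<Omega>\<^sub>0: "\<Omega>\<^sub>0 \<in> sets lebesgue" "\<Omega>\<^sub>0 \<subseteq> \<Omega>"
    and ip: "inner_product_on Y ip"
    and \<rho>: "\<rho>\<^sub>1 > 0" "\<And>v. v \<in> Y \<Longrightarrow> \<rho>\<^sub>1 * H1_norm \<Omega> v \<le> ip_norm ip v"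
    and z: "z \<in> L2 \<Omega>\<^sub>0" and \<alpha>: "\<alpha> > 0"
    and a: "bilinear_form_on Y a" "bdd_above (a_quotients Y ip a)"
    and coer: "bdd_below (coercivity_quotients Y ip a)" "0 < coercivity_const Y ip a"
    and b: "\<And>v. v \<in> Y \<Longrightarrow> linear (\<lambda>w. b w v)" "\<And>w. linear_form_on Y (b w)"
      "bdd_above (b_quotients Y ip b)"
    and f: "linear_form_on Y f"
    and "Y\<^sub>N \<subseteq> Y"
    and opt: "optimality_system \<Omega>\<^sub>0 z \<alpha> Uad Y a b f u y p"
    and opt\<^sub>N: "optimality_system \<Omega>\<^sub>0 z \<alpha> Uad Y\<^sub>N a b f u\<^sub>N y\<^sub>N p\<^sub>N"
    and "u\<^sub>N \<noteq> 0"
  shows "norm (u - u\<^sub>N) \<le> control_error_bound \<Omega>\<^sub>0 z \<alpha> \<rho>\<^sub>1 Y ip a b f u\<^sub>N y\<^sub>N p\<^sub>N"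
proof -
  let ?\<beta> = "coercivity_const Y ip a" and ?\<kappa> = "control_const Y ip b"
  let ?n = "ip_norm ip" and ?L = "L2_inner \<Omega>\<^sub>0"
  let ?r = "state_residual a b f u\<^sub>N y\<^sub>N" and ?s = "adjoint_residual \<Omega>\<^sub>0 z a y\<^sub>N p\<^sub>N"
  let ?R = "dual_norm Y ip ?r" and ?S = "dual_norm Y ip ?s"
  note [simp] = fun_vs.subspace_diff[OF Y(1)]
  have mem [simp]: "u \<in> Uad" "u\<^sub>N \<in> Uad" "y \<in> Y" "p \<in> Y" "y\<^sub>N \<in> Y" "p\<^sub>N \<in> Y"
    using opt opt\<^sub>N \<open>Y\<^sub>N \<subseteq> Y\<close> by (auto simp: optimality_system_def)
  have YL: "v \<in> L2 \<Omega>\<^sub>0" if "v \<in> Y" for v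
    using L2_mono[OF _ \<Omega>\<^sub>0] that Y(3) by auto
  have al: "linear_form_on Y (a v)" "linear_form_on Y (\<lambda>w. a w v)" if "v \<in> Y" for v
    using a that by (auto simp: bilinear_form_on_def)
  note diff = linear_form_on_diff[OF Y(1)]
  have pos: "a v v \<noteq> 0" if "v \<in> Y" "v \<noteq> 0" for v
    using coercivity_const_le[OF Y(1) ip a(1) coer(1) that(1)] coer(2) ip_norm_pos[OF ip that]
    by (smt (verit) mult_pos_pos zero_less_power)
  have ll: "linear_form_on Y (?L (y\<^sub>N - z))"
    using YL z L2_diff[of y\<^sub>N \<Omega>\<^sub>0 z]
    by (auto simp: linear_form_on_def L2_inner_add_right L2_inner_scale_right)
  have bf: "linear_form_on Y (\<lambda>v. b u\<^sub>N v + f v)"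
    using b(2)[of u\<^sub>N] f by (auto simp: linear_form_on_def algebra_simps)
  obtain y' where y' [simp]: "y' \<in> Y" and y'_eq: "\<And>v. v \<in> Y \<Longrightarrow> a y' v = b u\<^sub>N v + f v"
    using Lax_Milgram[OF Y(1,2) a(1) bf pos] by blast
  \<comment> \<open>The unknown sits in the second argument, hence the flipped form. The data is
    \<open>y\<^sub>N\<close> rather than \<open>y'\<close>, so that the adjoint residual represents
    exactly \<open>p' - p\<^sub>N\<close>.\<close>
  obtain p' where p' [simp]: "p' \<in> Y" and p'_eq: "\<And>v. v \<in> Y \<Longrightarrow> a v p' = ?L (y\<^sub>N - z) v"
    using Lax_Milgram[OF Y(1,2) bilinear_form_on_flip[OF a(1)] ll pos] by blast
  have "?r v = a (y' - y\<^sub>N) v" if "v \<in> Y" for v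
    using that y'_eq diff[OF al(2)] by (simp add: state_residual_def)
  then have R: "?\<beta> * ?n (y' - y\<^sub>N) \<le> ?R" "0 \<le> ?R"
    using norm_le_residual[OF Y(1) ip a coer, of "y' - y\<^sub>N" ?r] Y(4) by auto
  have "?s v = a v (p' - p\<^sub>N)" if "v \<in> Y" for v
    using that p'_eq diff[OF al(1)] by (simp add: adjoint_residual_def)
  then have S: "?\<beta> * ?n (p' - p\<^sub>N) \<le> ?S" "0 \<le> ?S"
    using norm_le_residual[OF Y(1) ip a coer, of "p' - p\<^sub>N" ?s] Y(4) by auto
  let ?d = "u - u\<^sub>N" and ?e = "y - y'" and ?g = "y\<^sub>N - y'"
  have bdiff: "b (w - w') v = b w v - b w' v" if "v \<in> Y" for w w' v
    using linear_diff[OF b(1)[OF that]] .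
  have "b (u\<^sub>N - u) p + \<alpha> * (u \<bullet> (u\<^sub>N - u)) \<ge> 0" "b ?d p\<^sub>N + \<alpha> * (u\<^sub>N \<bullet> ?d) \<ge> 0"
    using opt opt\<^sub>N by (auto simp: optimality_system_def)
  then have "\<alpha> * (norm ?d)\<^sup>2 \<le> b ?d p\<^sub>N - b ?d p"
    by (simp add: bdiff power2_norm_eq_inner inner_diff_left inner_diff_right inner_commute algebra_simps)
  also have "\<dots> = - b ?d (p' - p\<^sub>N) + b ?d (p' - p)"
    by (simp add: diff[OF b(2)])
  \<comment> \<open>Subtract the state equations for \<open>y\<close> and \<open>y'\<close> tested
    with \<open>p' - p\<close>; next, subtract the adjoint equations tested with \<open>?e\<close>.
    Then \<open>y\<^sub>N - y\<close> is written as \<open>?g - ?e\<close>.\<close>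
  also have "b ?d (p' - p) = a ?e (p' - p)"
    using opt y'_eq by (simp add: diff[OF al(2)] bdiff optimality_system_def)
  also have "\<dots> = ?L (y\<^sub>N - z) ?e - ?L (y - z) ?e"
    using opt p'_eq by (simp add: diff[OF al(1)] optimality_system_def)
  also have "\<dots> = ?L ?g ?e - ?L ?e ?e"
    using YL z by (simp add: L2_inner_diff_left L2_diff)
  also have "\<dots> \<le> ?L ?g ?g / 4"
  proof -
    \<comment> \<open>Completing the square: the inner product of \<open>?g / 2 - ?e\<close> with
      itself is nonnegative. The negative term in \<open>?e\<close> thus absorbs the unknown state
      error.\<close>
    let ?h = "scaleF (1 / 2) ?g"
    have h: "?h \<in> L2 \<Omega>\<^sub>0" "?e \<in> L2 \<Omega>\<^sub>0" "?g \<in> L2 \<Omega>\<^sub>0"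
      using YL by (auto intro: L2_scale L2_diff)
    have "?L (?h - ?e) (?h - ?e) = ?L ?h ?h - ?L ?h ?e - ?L ?e ?h + ?L ?e ?e"
      using h by (simp only: L2_inner_diff_left L2_inner_diff_right L2_diff)
    also have "\<dots> = ?L ?g ?g / 4 - ?L ?g ?e + ?L ?e ?e"
      unfolding L2_inner_scale_right L2_inner_commute[of _ ?h] by (simp add: L2_inner_commute)
    finally show ?thesis
      using L2_inner_self_nonneg[of \<Omega>\<^sub>0 "?h - ?e"] by linarith
  qed
  also have "- b ?d (p' - p\<^sub>N) \<le> ?\<kappa> * ?S / ?\<beta> * norm ?d"
  proof -
    \<comment> \<open>The nonzero \<open>u\<^sub>N\<close> witnesses that the control space is
      nontrivial.\<close>
    have \<kappa>: "0 \<le> ?\<kappa>"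
      by (rule control_const_nonneg[OF Y(1) ip b(3) \<open>u\<^sub>N \<noteq> 0\<close> Y(4)])
    have "- b ?d (p' - p\<^sub>N) \<le> ?\<kappa> * (norm ?d * ?n (p' - p\<^sub>N))"
      using abs_le_control_const[OF Y(1) ip b(1) b(2) b(3), of "p' - p\<^sub>N" ?d] by simp
    also have "\<dots> \<le> ?\<kappa> * (norm ?d * (?S / ?\<beta>))"
      using S(1) coer(2) \<kappa> by (intro mult_left_mono) (auto simp: field_simps)
    finally show ?thesis
      by (simp add: ac_simps)
  qed
  also have "?L ?g ?g / 4 \<le> (?R / (\<rho>\<^sub>1 * ?\<beta>))\<^sup>2 / 4"
  proof -
    \<comment> \<open>The sign is reversed to match the orientation of the state residual. The chain
      from the L2 norm through the H1 norm to \<open>?n\<close> then produces the factor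
      1/\<open>\<rho>\<^sub>1\<close>.\<close>
    have g: "?L ?g ?g = ?L (y' - y\<^sub>N) (y' - y\<^sub>N)"
      by (simp add: L2_inner_def algebra_simps)
    have H: "0 \<le> H1_norm \<Omega> (y' - y\<^sub>N)"
      by (auto simp: H1_norm_def intro!: add_nonneg_nonneg sum_nonneg L2_inner_self_nonneg)
    have "?\<beta> * (\<rho>\<^sub>1 * H1_norm \<Omega> (y' - y\<^sub>N)) \<le> ?\<beta> * ?n (y' - y\<^sub>N)"
      using \<rho>(2) coer(2) by (intro mult_left_mono) auto
    then have "?\<beta> * (\<rho>\<^sub>1 * H1_norm \<Omega> (y' - y\<^sub>N)) \<le> ?R"
      using R(1) by linarith
    then have "H1_norm \<Omega> (y' - y\<^sub>N) \<le> ?R / (\<rho>\<^sub>1 * ?\<beta>)"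
      using \<rho>(1) coer(2) by (simp add: pos_le_divide_eq ac_simps)
    then have "(H1_norm \<Omega> (y' - y\<^sub>N))\<^sup>2 \<le> (?R / (\<rho>\<^sub>1 * ?\<beta>))\<^sup>2"
      using H by (intro power_mono) auto
    moreover have "?L (y' - y\<^sub>N) (y' - y\<^sub>N) \<le> (H1_norm \<Omega> (y' - y\<^sub>N))\<^sup>2"
      using L2_inner_self_le_H1_norm[OF _ \<Omega>\<^sub>0] Y(3) by (simp add: subset_iff)
    ultimately show ?thesis
      unfolding g by simp
  qed
  finally have "\<alpha> * (norm ?d)\<^sup>2 \<le> ?\<kappa> * ?S / ?\<beta> * norm ?d + (?R / (\<rho>\<^sub>1 * ?\<beta>))\<^sup>2 / 4"
    by simp
  moreover have "0 \<le> ?\<kappa> * ?S / ?\<beta>" "0 \<le> ?R / (\<rho>\<^sub>1 * ?\<beta>)"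
    using R S \<rho> coer(2) control_const_nonneg[OF Y(1) ip b(3) \<open>u\<^sub>N \<noteq> 0\<close> Y(4)] by auto
  ultimately have "norm ?d \<le> ?R / (\<rho>\<^sub>1 * ?\<beta>) / sqrt \<alpha> + ?\<kappa> * ?S / ?\<beta> / \<alpha>"
    using \<alpha> quadratic_inequality_bound by blast
  then show ?thesis
    by (simp add: control_error_bound_def ac_simps)
qed

theorem corollary4p3:
  fixes \<P> :: "(real^'m::finite) set"
    and \<Omega> \<Omega>\<^sub>0 :: "(real^'d::finite) set"
    and Y Y\<^sub>N :: "(real^'d \<Rightarrow> real) set"
    and ip :: "(real^'d \<Rightarrow> real) \<Rightarrow> (real^'d \<Rightarrow> real) \<Rightarrow> real"
    and Uad :: "'u::{real_inner, complete_space} set"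
    and z :: "real^'d \<Rightarrow> real"
    and \<alpha> \<rho>\<^sub>1 \<rho>\<^sub>2 \<gamma>\<^sub>0 \<beta>\<^sub>0 \<kappa>\<^sub>0 \<sigma>\<^sub>0 :: real
    and a :: "real^'m \<Rightarrow> (real^'d \<Rightarrow> real) \<Rightarrow> (real^'d \<Rightarrow> real) \<Rightarrow> real"
    and b :: "real^'m \<Rightarrow> 'u \<Rightarrow> (real^'d \<Rightarrow> real) \<Rightarrow> real"
    and f :: "real^'m \<Rightarrow> (real^'d \<Rightarrow> real) \<Rightarrow> real"
    and \<mu> :: "real^'m"
    and u u\<^sub>N :: 'u
    and y p y\<^sub>N p\<^sub>N :: "real^'d \<Rightarrow> real"
  assumes "compact \<P>"
    and "CARD('d) \<in> {1, 2, 3}"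
    and "open \<Omega>" "connected \<Omega>" "bounded \<Omega>" "\<Omega> \<noteq> {}"
    and "open \<Omega>\<^sub>0" "\<Omega>\<^sub>0 \<subseteq> \<Omega>"
    and "P1_fe_space \<Omega> Y" "Y \<noteq> {0}"
    and "inner_product_on Y ip"
    and "\<rho>\<^sub>1 > 0" "\<rho>\<^sub>2 > 0"
    and "\<forall>v\<in>Y. \<rho>\<^sub>1 * H1_norm \<Omega> v \<le> ip_norm ip v \<and> ip_norm ip v \<le> \<rho>\<^sub>2 * H1_norm \<Omega> v"
    and "Uad \<noteq> {}" "closed Uad" "convex Uad"
    and "z \<in> L2 \<Omega>\<^sub>0"
    and "\<alpha> > 0"
    and "\<forall>\<nu>\<in>\<P>. bilinear_form_on Y (a \<nu>)"
    and "\<forall>\<nu>\<in>\<P>. bdd_above (a_quotients Y ip (a \<nu>)) \<and> continuity_const Y ip (a \<nu>) \<le> \<gamma>\<^sub>0"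
    and "\<beta>\<^sub>0 > 0"
    and "\<forall>\<nu>\<in>\<P>. bdd_below (coercivity_quotients Y ip (a \<nu>)) \<and> coercivity_const Y ip (a \<nu>) \<ge> \<beta>\<^sub>0"
    and "\<forall>\<nu>\<in>\<P>. (\<forall>v\<in>Y. linear (\<lambda>w. b \<nu> w v)) \<and> (\<forall>w. linear_form_on Y (b \<nu> w))"
    and "\<forall>\<nu>\<in>\<P>. bdd_above (b_quotients Y ip (b \<nu>)) \<and> control_const Y ip (b \<nu>) \<le> \<kappa>\<^sub>0"
    and "\<forall>\<nu>\<in>\<P>. linear_form_on Y (f \<nu>)"
    and "\<forall>\<nu>\<in>\<P>. bdd_above (f_quotients Y ip (f \<nu>)) \<and> Sup (f_quotients Y ip (f \<nu>)) \<le> \<sigma>\<^sub>0"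
    and "\<mu> \<in> \<P>"
    and "fun_vs.subspace Y\<^sub>N" "finite_dim Y\<^sub>N" "Y\<^sub>N \<subseteq> Y"
    and "optimality_system \<Omega>\<^sub>0 z \<alpha> Uad Y (a \<mu>) (b \<mu>) (f \<mu>) u y p"
    and "optimality_system \<Omega>\<^sub>0 z \<alpha> Uad Y\<^sub>N (a \<mu>) (b \<mu>) (f \<mu>) u\<^sub>N y\<^sub>N p\<^sub>N"
    and "u\<^sub>N \<noteq> 0"
    and "2 * control_error_bound \<Omega>\<^sub>0 z \<alpha> \<rho>\<^sub>1 Y ip (a \<mu>) (b \<mu>) (f \<mu>) u\<^sub>N y\<^sub>N p\<^sub>N / norm u\<^sub>N \<le> 1"
  shows "norm (u - u\<^sub>N) / norm u \<le>
    2 * control_error_bound \<Omega>\<^sub>0 z \<alpha> \<rho>\<^sub>1 Y ip (a \<mu>) (b \<mu>) (f \<mu>) u\<^sub>N y\<^sub>N p\<^sub>N / norm u\<^sub>N"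
proof -
  let ?\<Delta> = "control_error_bound \<Omega>\<^sub>0 z \<alpha> \<rho>\<^sub>1 Y ip (a \<mu>) (b \<mu>) (f \<mu>) u\<^sub>N y\<^sub>N p\<^sub>N"
  have le: "norm (u - u\<^sub>N) \<le> ?\<Delta>"
  proof (rule control_error_le[where \<Omega> = \<Omega>])
    show "fun_vs.subspace Y" "finite_dim Y" "Y \<subseteq> L2 \<Omega>"
      using \<open>P1_fe_space \<Omega> Y\<close> by (auto simp: P1_fe_space_def H1_def)
    show "\<Omega>\<^sub>0 \<in> sets lebesgue"
      using \<open>open \<Omega>\<^sub>0\<close> by simp
    show "0 < coercivity_const Y ip (a \<mu>)"
      using assms by force
  qed (use assms in auto)
  have "norm u\<^sub>N \<le> norm u + norm (u - u\<^sub>N)"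
    by (metis add.commute norm_minus_commute norm_triangle_sub)
  moreover have "2 * ?\<Delta> \<le> norm u\<^sub>N"
    using assms(34,35) by (simp add: pos_divide_le_eq)
  \<comment> \<open>In particular \<open>u\<close> is nonzero, so the relative error is a genuine
    quotient.\<close>
  ultimately have "norm u\<^sub>N / 2 \<le> norm u"
    using le by linarith
  moreover have "0 \<le> ?\<Delta>"
    using le norm_ge_zero[of "u - u\<^sub>N"] by linarith
  ultimately have "norm (u - u\<^sub>N) / norm u \<le> ?\<Delta> / (norm u\<^sub>N / 2)"
    using le \<open>u\<^sub>N \<noteq> 0\<close> by (intro frac_le) auto
  then show ?thesis
    by (simp add: mult.commute)
qed

end
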